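(* For each non-negative integer $n$, $M_2(n)+N_2(n)\le 2p_2(n)$.
   Context: $p(m,n)$ is the number of partitions of $n$ with exactly $m$ parts, and $p_2(n)=\sum_{m}m^2p(m,n)$. The rank of a partition is its largest part minus its number of parts; $N(m,n)$ is the number of partitions of $n$ with rank $m$, and $N_2(n)=\sum_{m\in\mathbb{Z}}m^2N(m,n)$ (second Atkin–Garvan rank moment). $M(m,n)$ is defined as the coefficient of $z^mq^n$ in $\prod_{k\ge1}\frac{1-q^k}{(1-zq^k)(1-z^{-1}q^k)}$ (the crank generating function), and $M_2(n)=\sum_{m\in\mathbb{Z}}m^2M(m,n)$ is the second Atkin–Garvan crank moment. *)

theory Defs
  imports
    "HOL-Complex_Analysis.Complex_Analysis"
    "HOL-Library.Groups_Big_Fun"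
begin

definition partitions :: "nat \<Rightarrow> nat multiset set" where
  "partitions n = {P. 0 \<notin># P \<and> sum_mset P = n}"

definition p_parts :: "nat \<Rightarrow> nat \<Rightarrow> nat" where
  "p_parts m n = card {P \<in> partitions n. size P = m}"

text \<open>The largest part of the empty partition is taken to be 0, so the empty partition has rank 0.\<close>

definition largest_part :: "nat multiset \<Rightarrow> nat" where
  "largest_part P = (if P = {#} then 0 else Max_mset P)"

definition partition_rank :: "nat multiset \<Rightarrow> int" where
  "partition_rank P = int (largest_part P) - int (size P)"

definition N_rank :: "int \<Rightarrow> nat \<Rightarrow> nat" where
  "N_rank m n = card {P \<in> partitions n. partition_rank P = m}"

text \<open>
  The crank generating function is a power series in \<open>q = fps_X\<close> whose coefficients are
  Laurent series in \<open>z = fls_X\<close>. The infinite product is taken in the \<open>q\<close>-adic topology; its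
  index is shifted by one because \<open>prodinf\<close> starts at 0. The scalars are rational because
  division of power series requires a field.
\<close>

definition crank_factor :: "nat \<Rightarrow> rat fls fps" where
  "crank_factor k = (1 - fps_X ^ k) /
     ((1 - fps_const fls_X * fps_X ^ k) * (1 - fps_const fls_X_inv * fps_X ^ k))"

definition crank_gf :: "rat fls fps" where
  "crank_gf = prodinf (\<lambda>k. crank_factor (Suc k))"

definition M_crank :: "int \<Rightarrow> nat \<Rightarrow> rat" where
  "M_crank m n = fls_nth (fps_nth crank_gf n) m"

text \<open>
  \<open>Sum_any\<close> sums over the support of a function and is 0 if the support is infinite. All
  supports are finite here; see the lemmas at the end.
\<close>

definition p2 :: "nat \<Rightarrow> nat" where
  "p2 n = Sum_any (\<lambda>m. m\<^sup>2 * p_parts m n)"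

definition N2 :: "nat \<Rightarrow> int" where
  "N2 n = Sum_any (\<lambda>m. m\<^sup>2 * int (N_rank m n))"

definition M2 :: "nat \<Rightarrow> rat" where
  "M2 n = Sum_any (\<lambda>m. (of_int m)\<^sup>2 * M_crank m n)"

lemma size_le_of_partition: "P \<in> partitions n \<Longrightarrow> size P \<le> n"
proof -
  have "0 \<notin># P \<Longrightarrow> size P \<le> sum_mset P" for P :: "nat multiset"
    by (induction P) auto
  then show "P \<in> partitions n \<Longrightarrow> size P \<le> n" by (auto simp: partitions_def)
qed

lemma part_le_of_partition: "P \<in> partitions n \<Longrightarrow> x \<in># P \<Longrightarrow> x \<le> n"
  by (auto simp: partitions_def dest!: multi_member_split)

lemma finite_partitions: "finite (partitions n)"
proof (rule finite_subset)
  show "partitions n \<subseteq> mset ` {xs. set xs \<subseteq> {..n} \<and> length xs \<le> n}"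
  proof
    fix P assume P: "P \<in> partitions n"
    obtain xs where xs: "mset xs = P" using ex_mset by blast
    have "length xs \<le> n" using size_le_of_partition[OF P] xs by auto
    moreover have "set xs \<subseteq> {..n}" using part_le_of_partition[OF P] xs by auto
    ultimately show "P \<in> mset ` {xs. set xs \<subseteq> {..n} \<and> length xs \<le> n}" using xs by blast
  qed
qed (simp add: finite_lists_length_le)

lemma p_parts_eq_0:
  assumes "m > n"
  shows "p_parts m n = 0"
proof -
  have "{P \<in> partitions n. size P = m} = {}"
    using assms size_le_of_partition[of _ n] by force
  then show ?thesis by (simp only: p_parts_def card.empty)
qed

lemma finite_support_N_rank: "finite {m. N_rank m n \<noteq> 0}"
proof (rule finite_subset)
  show "{m. N_rank m n \<noteq> 0} \<subseteq> partition_rank ` partitions n"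
    by (auto simp: N_rank_def card_eq_0_iff)
qed (simp add: finite_partitions)

definition crank_denom :: "nat \<Rightarrow> rat fls fps" where
  "crank_denom k = (1 - fps_const fls_X * fps_X ^ k) * (1 - fps_const fls_X_inv * fps_X ^ k)"

lemma crank_denom_nth_0: "k > 0 \<Longrightarrow> fps_nth (crank_denom k) 0 = 1"
  by (simp add: crank_denom_def fps_mult_nth_0)

lemma crank_factor_eq: "k > 0 \<Longrightarrow> crank_factor k = (1 - fps_X ^ k) * inverse (crank_denom k)"
  unfolding crank_factor_def crank_denom_def[symmetric]
  by (subst fps_divide_unit) (simp_all add: crank_denom_nth_0)

lemma crank_factor_nth:
  assumes "j < k"
  shows "fps_nth (crank_factor k) j = (if j = 0 then 1 else 0)"
proof -
  define E :: "rat fls fps" where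
    "E = fps_const fls_X + fps_const fls_X_inv - fps_const fls_X * fps_const fls_X_inv * fps_X ^ k"
  have "1 - x = (1 - a * x) * (1 - b * x) + x * (a + b - a * b * x - 1)" for a b x :: "rat fls fps"
    by (simp add: algebra_simps)
  then have "1 - fps_X ^ k = crank_denom k + fps_X ^ k * (E - 1)"
    unfolding crank_denom_def E_def .
  moreover have "crank_factor k = (1 - fps_X ^ k) * inverse (crank_denom k)"
    using assms by (intro crank_factor_eq) simp
  ultimately have "crank_factor k = crank_denom k * inverse (crank_denom k)
      + fps_X ^ k * ((E - 1) * inverse (crank_denom k))"
    by (simp only: ring_distribs mult.assoc)
  also have "crank_denom k * inverse (crank_denom k) = 1"
    using assms by (intro inverse_mult_eq_1') (simp add: crank_denom_nth_0)
  finally show ?thesis using assms by (simp add: fps_X_power_mult_nth)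
qed

lemma crank_partial_nth:
  assumes "n \<ge> j"
  shows "fps_nth (\<Prod>i\<le>n. crank_factor (Suc i)) j = fps_nth (\<Prod>i\<le>j. crank_factor (Suc i)) j"
  using assms
proof (induction n rule: dec_induct)
  case (step n)
  let ?Q = "\<Prod>i\<le>n. crank_factor (Suc i)"
  have "fps_nth (\<Prod>i\<le>Suc n. crank_factor (Suc i)) j = fps_nth (?Q * crank_factor (Suc (Suc n))) j"
    by simp
  also have "\<dots> = (\<Sum>i=0..j. fps_nth ?Q i * (if j - i = 0 then 1 else 0))"
    unfolding fps_mult_nth using step.hyps by (intro sum.cong) (auto simp: crank_factor_nth)
  also have "\<dots> = (\<Sum>i\<in>{j}. fps_nth ?Q i)"
    by (rule sum.mono_neutral_cong_right) auto
  finally show ?case using step.IH by simp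
qed simp

lemma crank_factor_has_prod: "(\<lambda>k. crank_factor (Suc k)) has_prod crank_gf"
proof -
  define G where "G = Abs_fps (\<lambda>j. fps_nth (\<Prod>i\<le>j. crank_factor (Suc i)) j)"
  have "(\<lambda>n. \<Prod>i\<le>n. crank_factor (Suc i)) \<longlonglongrightarrow> G"
  proof (rule tendsto_fpsI)
    show "\<forall>\<^sub>F n in sequentially. fps_nth (\<Prod>i\<le>n. crank_factor (Suc i)) j = fps_nth G j" for j
      using eventually_ge_at_top[of j]
      by (rule eventually_mono) (unfold G_def fps_nth_Abs_fps, rule crank_partial_nth)
  qed
  moreover have "fps_nth G 0 = 1" by (simp add: G_def crank_factor_nth)
  then have "G \<noteq> 0" by auto
  ultimately have "(\<lambda>k. crank_factor (Suc k)) has_prod G"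
    by (simp add: has_prod_def raw_has_prod_def)
  then show ?thesis unfolding crank_gf_def using has_prod_unique by metis
qed

lemma crank_gf_nth: "fps_nth crank_gf n = fps_nth (\<Prod>i\<le>n. crank_factor (Suc i)) n"
proof -
  have "crank_gf \<noteq> 0"
  proof
    assume "crank_gf = 0"
    then obtain i where "crank_factor (Suc i) = 0"
      using crank_factor_has_prod by (auto simp: has_prod_0_iff)
    then show False using crank_factor_nth[of 0 "Suc i"] by simp
  qed
  then have "(\<lambda>n. \<Prod>i\<le>n. crank_factor (Suc i)) \<longlonglongrightarrow> crank_gf"
    using crank_factor_has_prod by (auto simp: has_prod_def raw_has_prod_def)
  then have "\<forall>\<^sub>F m in sequentially. fps_nth (\<Prod>i\<le>m. crank_factor (Suc i)) n = fps_nth crank_gf n"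
    by (simp add: tendsto_fps_iff)
  then have "\<forall>\<^sub>F m in sequentially. fps_nth crank_gf n = fps_nth (\<Prod>i\<le>n. crank_factor (Suc i)) n"
    using eventually_ge_at_top[of n]
    by eventually_elim (metis crank_partial_nth)
  then show ?thesis by simp
qed

definition z_bounded :: "nat \<Rightarrow> rat fls \<Rightarrow> bool" where
  "z_bounded a f \<longleftrightarrow> (\<forall>m. \<bar>m\<bar> > int a \<longrightarrow> fls_nth f m = 0)"

lemma z_bounded_mult:
  assumes "z_bounded a f" "z_bounded b g"
  shows "z_bounded (a + b) (f * g)"
  unfolding z_bounded_def
proof (intro allI impI)
  fix m :: int assume m: "\<bar>m\<bar> > int (a + b)"
  have "fls_nth f i * fls_nth g (m - i) = 0" for i
  proof (cases "\<bar>i\<bar> > int a")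
    case False
    then have "\<bar>m - i\<bar> > int b" using m by simp
    then show ?thesis using assms by (simp add: z_bounded_def)
  qed (use assms in \<open>simp add: z_bounded_def\<close>)
  then show "fls_nth (f * g) m = 0"
    unfolding fls_times_nth(2) by (intro sum.neutral) blast
qed

lemma z_bounded_sum: "(\<And>i. i \<in> A \<Longrightarrow> z_bounded a (f i)) \<Longrightarrow> z_bounded a (sum f A)"
  by (auto simp: z_bounded_def fls_nth_sum intro!: sum.neutral)

definition qz_bounded :: "rat fls fps \<Rightarrow> bool" where
  "qz_bounded f \<longleftrightarrow> (\<forall>n. z_bounded n (fps_nth f n))"

lemma qz_bounded_mult: "qz_bounded f \<Longrightarrow> qz_bounded g \<Longrightarrow> qz_bounded (f * g)"
  unfolding qz_bounded_def fps_mult_nth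
proof (intro allI z_bounded_sum)
  fix n i :: nat assume "\<forall>n. z_bounded n (fps_nth f n)" "\<forall>n. z_bounded n (fps_nth g n)" "i \<in> {0..n}"
  then show "z_bounded n (fps_nth f i * fps_nth g (n - i))"
    using z_bounded_mult[of i "fps_nth f i" "n - i" "fps_nth g (n - i)"] by simp
qed

lemma qz_bounded_inverse:
  assumes "qz_bounded f" "fps_nth f 0 = 1"
  shows "qz_bounded (inverse f)"
  unfolding qz_bounded_def
proof
  fix n show "z_bounded n (fps_nth (inverse f) n)"
  proof (induction n rule: less_induct)
    case (less n)
    show ?case
    proof (cases "n = 0")
      case True
      then show ?thesis using assms by (simp add: z_bounded_def)
    next
      case False
      have "(f * inverse f) = 1" using assms by (intro inverse_mult_eq_1') simp
      then have "(\<Sum>i=0..n. fps_nth f i * fps_nth (inverse f) (n - i)) = 0"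
        using False by (metis fps_mult_nth fps_one_nth)
      then have eq: "fps_nth (inverse f) n = - (\<Sum>i=Suc 0..n. fps_nth f i * fps_nth (inverse f) (n - i))"
        using assms(2) by (simp add: sum.atLeast_Suc_atMost eq_neg_iff_add_eq_0)
      have "z_bounded n (\<Sum>i=Suc 0..n. fps_nth f i * fps_nth (inverse f) (n - i))"
      proof (rule z_bounded_sum)
        fix i assume i: "i \<in> {Suc 0..n}"
        then have "z_bounded (i + (n - i)) (fps_nth f i * fps_nth (inverse f) (n - i))"
          using less.IH[of "n - i"] assms(1) by (intro z_bounded_mult) (auto simp: qz_bounded_def)
        then show "z_bounded n (fps_nth f i * fps_nth (inverse f) (n - i))" using i by simp
      qed
      then show ?thesis unfolding eq by (simp add: z_bounded_def)
    qed
  qed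
qed

lemma qz_bounded_crank_factor: "k > 0 \<Longrightarrow> qz_bounded (crank_factor k)"
proof -
  assume k: "k > 0"
  have "qz_bounded (1 - fps_const c * fps_X ^ k)" if "c \<in> {1, fls_X, fls_X_inv}" for c
    using that k by (auto simp: qz_bounded_def z_bounded_def fps_X_power_nth)
  from this[of 1] this[of fls_X] this[of fls_X_inv] show ?thesis
    using k by (auto simp: crank_factor_eq crank_denom_nth_0 crank_denom_def
        intro!: qz_bounded_mult qz_bounded_inverse)
qed

lemma M_crank_eq_0:
  assumes "\<bar>m\<bar> > int n"
  shows "M_crank m n = 0"
proof -
  have "qz_bounded (\<Prod>i\<le>j. crank_factor (Suc i))" for j
    by (induction j) (auto intro: qz_bounded_mult qz_bounded_crank_factor)
  then show ?thesis
    using assms by (simp add: M_crank_def crank_gf_nth qz_bounded_def z_bounded_def)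
qed

end

theory Submission
  imports Defs
begin

text \<open>
  By conjugation the largest part \<open>L\<close> and the number of parts \<open>S\<close> are equidistributed over the
  partitions of \<open>n\<close>, so \<open>N\<^sub>2(n) = \<Sum> (L - S)\<^sup>2 = 2 p\<^sub>2(n) - 2 \<Sum> L S\<close>. Applying
  \<open>(z d/dz)\<^sup>2\<close> to the crank product at \<open>z = 1\<close> gives Dyson's identity \<open>M\<^sub>2(n) = 2 n p(n)\<close>. The claim
  is therefore \<open>n p(n) \<le> \<Sum> L S\<close>, which holds term by term because \<open>n \<le> L S\<close> for every partition.
\<close>

section \<open>Conjugation\<close>

text \<open>Upper bounds rather than exact values make this family and
  \<open>partitions_size\<close> obey the same recurrence. Conjugation is then proved by comparing
  recurrences, without constructing conjugate partitions.\<close>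

definition partitions_max :: "nat \<Rightarrow> nat \<Rightarrow> nat multiset set" where
  "partitions_max N n = {P \<in> partitions n. \<forall>x\<in>#P. x \<le> N}"

definition partitions_size :: "nat \<Rightarrow> nat \<Rightarrow> nat multiset set" where
  "partitions_size N n = {P \<in> partitions n. size P \<le> N}"

lemma finite_partitions_max: "finite (partitions_max N n)"
  by (simp add: partitions_max_def finite_partitions)

lemma finite_partitions_size: "finite (partitions_size N n)"
  by (simp add: partitions_size_def finite_partitions)

lemma partitions_max_0: "partitions_max 0 n = (if n = 0 then {{#}} else {})"
proof -
  have "P = {#}" if "P \<in> partitions_max 0 n" for P
  proof (rule ccontr)
    assume "P \<noteq> {#}"
    then obtain x where "x \<in># P" by blast
    with that show False by (auto simp: partitions_max_def partitions_def)
  qed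
  moreover have "{#} \<in> partitions_max 0 n \<longleftrightarrow> n = 0"
    by (auto simp: partitions_max_def partitions_def)
  ultimately show ?thesis by (cases "n = 0") auto
qed

lemma partitions_size_0: "partitions_size 0 n = (if n = 0 then {{#}} else {})"
  by (auto simp: partitions_size_def partitions_def)

text \<open>Split by whether \<open>Suc N\<close> occurs as a part. If it does, delete one copy;
  other copies may remain, so the bound stays \<open>Suc N\<close>.\<close>

lemma card_partitions_max_Suc:
  "card (partitions_max (Suc N) n) = card (partitions_max N n)
     + (if Suc N \<le> n then card (partitions_max (Suc N) (n - Suc N)) else 0)"
proof -
  let ?C = "{P \<in> partitions_max (Suc N) n. Suc N \<in># P}"
  have split: "partitions_max (Suc N) n = partitions_max N n \<union> ?C"
    by (auto simp: partitions_max_def le_Suc_eq)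
  have disj: "partitions_max N n \<inter> ?C = {}"
    by (auto simp: partitions_max_def)
  have "card ?C = (if Suc N \<le> n then card (partitions_max (Suc N) (n - Suc N)) else 0)"
  proof (cases "Suc N \<le> n")
    case True
    have "bij_betw (add_mset (Suc N)) (partitions_max (Suc N) (n - Suc N)) ?C"
    proof (rule bij_betw_byWitness[where f' = "\<lambda>P. P - {#Suc N#}"])
      show "add_mset (Suc N) ` partitions_max (Suc N) (n - Suc N) \<subseteq> ?C"
        using True by (auto simp: partitions_max_def partitions_def)
      show "(\<lambda>P. P - {#Suc N#}) ` ?C \<subseteq> partitions_max (Suc N) (n - Suc N)"
        by (auto simp: partitions_max_def partitions_def dest!: multi_member_split)
    qed auto
    then show ?thesis using True by (simp add: bij_betw_same_card)
  next
    case False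
    then have "?C = {}"
      using part_le_of_partition[of _ n "Suc N"] by (auto simp: partitions_max_def)
    then show ?thesis using False by (simp only: card.empty if_False)
  qed
  moreover have "card (partitions_max (Suc N) n) = card (partitions_max N n) + card ?C"
    by (subst split, rule card_Un_disjoint)
       (simp_all only: disj finite_partitions_max finite_Collect_conjI simp_thms,
        simp add: finite_partitions_max)
  ultimately show ?thesis by simp
qed

lemma sum_mset_image_Suc: "sum_mset (image_mset Suc P) = sum_mset P + size P"
  by (induction P) auto

lemma image_pred_image_Suc: "image_mset (\<lambda>x. x - 1) (image_mset Suc P) = P"
  by (induction P) simp_all

lemma filter_nonzero_replicate_mset_0:
  "filter_mset (\<lambda>x. x \<noteq> 0) (replicate_mset m (0::nat)) = {#}"
  by simp

lemma filter_nonzero_mset: "0 \<notin># P \<Longrightarrow> filter_mset (\<lambda>x. x \<noteq> (0::nat)) P = P"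
  by (induction P) auto

text \<open>A partition with exactly \<open>N + 1\<close> parts loses the first column of its Ferrers diagram.\<close>

lemma card_partitions_size_Suc:
  "card (partitions_size (Suc N) n) = card (partitions_size N n)
     + (if Suc N \<le> n then card (partitions_size (Suc N) (n - Suc N)) else 0)"
proof -
  let ?C = "{P \<in> partitions n. size P = Suc N}"
  have split: "partitions_size (Suc N) n = partitions_size N n \<union> ?C"
    by (auto simp: partitions_size_def le_Suc_eq)
  have disj: "partitions_size N n \<inter> ?C = {}"
    by (auto simp: partitions_size_def)
  have "card ?C = (if Suc N \<le> n then card (partitions_size (Suc N) (n - Suc N)) else 0)"
  proof (cases "Suc N \<le> n")
    case True
    \<comment> \<open>\<open>?f\<close> pads with zeros to exactly \<open>Suc N\<close> entries and
      raises each by 1, restoring the column. \<open>?g\<close> lowers every part by 1 and drops the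
      zeros that arise from parts equal to 1.\<close>
    let ?f = "\<lambda>Q. image_mset Suc (Q + replicate_mset (Suc N - size Q) 0)"
    let ?g = "\<lambda>P. filter_mset (\<lambda>x. x \<noteq> 0) (image_mset (\<lambda>x. x - 1) P)"
    have "bij_betw ?f (partitions_size (Suc N) (n - Suc N)) ?C"
    proof (rule bij_betw_byWitness[where f' = ?g])
      show "\<forall>Q\<in>partitions_size (Suc N) (n - Suc N). ?g (?f Q) = Q"
      proof
        fix Q assume "Q \<in> partitions_size (Suc N) (n - Suc N)"
        then have "0 \<notin># Q" by (simp add: partitions_size_def partitions_def)
        then show "?g (?f Q) = Q"
          unfolding image_pred_image_Suc filter_union_mset
            filter_nonzero_replicate_mset_0
          by (simp only: add_0_right) (rule filter_nonzero_mset)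
      qed
      show "?f ` partitions_size (Suc N) (n - Suc N) \<subseteq> ?C"
      proof (rule image_subsetI)
        fix Q assume Q: "Q \<in> partitions_size (Suc N) (n - Suc N)"
        let ?R = "Q + replicate_mset (Suc N - size Q) 0"
        have R: "size ?R = Suc N" "sum_mset ?R = n - Suc N"
          using Q by (simp_all add: partitions_size_def partitions_def)
        have "size (image_mset Suc ?R) = Suc N"
          using R(1) by (simp only: size_image_mset)
        moreover have "sum_mset (image_mset Suc ?R) = n"
          using True by (simp only: sum_mset_image_Suc R le_add_diff_inverse2)
        moreover have "0 \<notin># image_mset Suc ?R"
          by (simp only: set_image_mset) blast
        ultimately show "?f Q \<in> ?C"
          by (simp only: partitions_def mem_Collect_eq simp_thms)
      qed
      have *: "?f (?g P) = P \<and> ?g P \<in> partitions_size (Suc N) (n - Suc N)" if "P \<in> ?C" for P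
      proof -
        let ?R = "image_mset (\<lambda>x. x - 1) P"
        have P: "0 \<notin># P" "sum_mset P = n" "size P = Suc N"
          using that by (auto simp: partitions_def)
        have R: "image_mset Suc ?R = P"
          using P(1) by (induction P) auto
        \<comment> \<open>The dropped entries are all 0, so only their number must be recovered; the
          known total size \<open>Suc N\<close> determines it.\<close>
        have eq: "?R = ?g P + replicate_mset (count ?R 0) 0"
          using multiset_partition[of ?R "\<lambda>x. x \<noteq> 0"]
          by (simp only: not_not filter_eq_replicate_mset)
        have sz: "size ?R = size (?g P) + count ?R 0"
          using arg_cong[OF eq, of size] by (simp only: size_union size_replicate_mset)
        have sumR: "sum_mset ?R = sum_mset (?g P)"
          using arg_cong[OF eq, of sum_mset]
          by (simp only: sum_mset.union sum_mset_replicate_mset mult_0_right add_0_right)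
        have c: "count ?R 0 = Suc N - size (?g P)"
          using sz P(3) by (simp only: size_image_mset)
        have "?R = ?g P + replicate_mset (Suc N - size (?g P)) 0"
          using eq unfolding c .
        then have 1: "?f (?g P) = P" using R by (simp only:)
        have "sum_mset P = sum_mset ?R + Suc N"
          using sum_mset_image_Suc[of ?R] P(3) unfolding R by (simp only: size_image_mset)
        then have "sum_mset (?g P) = n - Suc N" using sumR P(2) by (simp only: add_diff_cancel_right')
        moreover have "size (?g P) \<le> Suc N"
          using sz P(3) by (simp only: size_image_mset le_add1)
        moreover have "0 \<notin># ?g P"
          by (simp only: set_mset_filter mem_Collect_eq) blast
        ultimately show ?thesis
          using 1 by (simp only: partitions_size_def partitions_def mem_Collect_eq simp_thms)
      qed
      show "\<forall>P\<in>?C. ?f (?g P) = P" "?g ` ?C \<subseteq> partitions_size (Suc N) (n - Suc N)"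
        using * by blast+
    qed
    then show ?thesis using True by (simp add: bij_betw_same_card)
  next
    case False
    then have "?C = {}"
      using size_le_of_partition[of _ n] by fastforce
    then show ?thesis using False by (simp only: card.empty if_False)
  qed
  moreover have "card (partitions_size (Suc N) n) = card (partitions_size N n) + card ?C"
    by (subst split, rule card_Un_disjoint)
       (simp_all only: disj finite_partitions_size, simp add: finite_partitions)
  ultimately show ?thesis by simp
qed

text \<open>Both sides have the same recurrence and the same values at \<open>N = 0\<close>. One
  term of the recurrence lowers \<open>N\<close> for the same \<open>n\<close>, the other lowers
  \<open>n\<close> for the same \<open>N\<close>, hence the nested inductions.\<close>

lemma card_partitions_max_eq_size: "card (partitions_max N n) = card (partitions_size N n)"
proof (induction N arbitrary: n)
  case 0
  then show ?case by (simp add: partitions_max_0 partitions_size_0)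
next
  case (Suc N)
  show ?case
  proof (induction n rule: less_induct)
    case (less n)
    then show ?case
      by (subst card_partitions_max_Suc, subst card_partitions_size_Suc) (simp add: Suc.IH)
  qed
qed

lemma largest_part_le_iff: "largest_part P \<le> N \<longleftrightarrow> (\<forall>x\<in>#P. x \<le> N)"
  by (auto simp: largest_part_def)

text \<open>Exact counts are differences of consecutive cumulative counts; \<open>m = 0\<close> has
  no predecessor and is itself a cumulative count.\<close>

lemma card_largest_part_eq:
  "card {P \<in> partitions n. largest_part P = m} = card {P \<in> partitions n. size P = m}"
proof (cases m)
  case 0
  have "{P \<in> partitions n. largest_part P = 0} = partitions_max 0 n"
    using largest_part_le_iff[of _ 0] by (auto simp: partitions_max_def)
  moreover have "{P \<in> partitions n. size P = 0} = partitions_size 0 n"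
    by (auto simp: partitions_size_def)
  ultimately show ?thesis using 0 card_partitions_max_eq_size by simp
next
  case (Suc k)
  have "{P \<in> partitions n. largest_part P = Suc k} = partitions_max (Suc k) n - partitions_max k n"
    unfolding partitions_max_def by (auto simp flip: largest_part_le_iff)
  moreover have "{P \<in> partitions n. size P = Suc k} = partitions_size (Suc k) n - partitions_size k n"
    by (auto simp: partitions_size_def)
  moreover have "partitions_max k n \<subseteq> partitions_max (Suc k) n"
    "partitions_size k n \<subseteq> partitions_size (Suc k) n"
    by (auto simp: partitions_max_def partitions_size_def)
  ultimately show ?thesis using Suc card_partitions_max_eq_size
    by (simp add: card_Diff_subset finite_partitions_max finite_partitions_size)
qed

section \<open>The moments \<open>p2\<close> and \<open>N2\<close> as sums over partitions\<close>

lemma Sum_any_card_fibres: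
  fixes g :: "'b \<Rightarrow> 'c::comm_semiring_1"
  assumes "finite A"
  shows "Sum_any (\<lambda>m. g m * of_nat (card {x \<in> A. s x = m})) = (\<Sum>x\<in>A. g (s x))"
proof -
  have "Sum_any (\<lambda>m. g m * of_nat (card {x \<in> A. s x = m}))
      = (\<Sum>m\<in>s ` A. g m * of_nat (card {x \<in> A. s x = m}))"
  proof (rule Sum_any.expand_superset)
    show "{m. g m * of_nat (card {x \<in> A. s x = m}) \<noteq> 0} \<subseteq> s ` A"
    proof
      \<comment> \<open>Outside the image of \<open>A\<close> the fibre is empty, so the support is
        finite and \<open>Sum_any\<close> does not take its default value 0.\<close>
      fix m assume "m \<in> {m. g m * of_nat (card {x \<in> A. s x = m}) \<noteq> 0}"
      then have "card {x \<in> A. s x = m} \<noteq> 0" by (auto intro: ccontr)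
      then have "{x \<in> A. s x = m} \<noteq> {}" by (metis card.empty)
      then show "m \<in> s ` A" by auto
    qed
  qed (use assms in simp)
  also have "\<dots> = (\<Sum>m\<in>s ` A. \<Sum>x | x \<in> A \<and> s x = m. g (s x))"
    by (intro sum.cong refl) (simp add: mult.commute)
  also have "\<dots> = (\<Sum>x\<in>A. g (s x))"
    using assms by (intro sum.group) auto
  finally show ?thesis .
qed

lemma p2_eq_sum: "p2 n = (\<Sum>P\<in>partitions n. (size P)\<^sup>2)"
  unfolding p2_def p_parts_def
  using Sum_any_card_fibres[OF finite_partitions, of "\<lambda>m. m\<^sup>2" n size] by simp

text \<open>This is where conjugation enters the moment computation.\<close>

lemma p2_eq_sum_largest_part: "p2 n = (\<Sum>P\<in>partitions n. (largest_part P)\<^sup>2)"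
  unfolding p2_def p_parts_def card_largest_part_eq[symmetric]
  using Sum_any_card_fibres[OF finite_partitions, of "\<lambda>m. m\<^sup>2" n largest_part] by simp

lemma N2_eq_sum: "N2 n = (\<Sum>P\<in>partitions n. (partition_rank P)\<^sup>2)"
  unfolding N2_def N_rank_def
  using Sum_any_card_fibres[OF finite_partitions, of "\<lambda>m. m\<^sup>2" n partition_rank] by simp

lemma N2_eq: "N2 n = 2 * int (p2 n) - 2 * (\<Sum>P\<in>partitions n. int (largest_part P * size P))"
proof -
  have "N2 n = (\<Sum>P\<in>partitions n. int ((largest_part P)\<^sup>2) + int ((size P)\<^sup>2)
      - 2 * int (largest_part P * size P))"
    unfolding N2_eq_sum partition_rank_def
    by (intro sum.cong refl) (simp add: power2_eq_square algebra_simps)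
  also have "\<dots> = int (p2 n) + int (p2 n) - 2 * (\<Sum>P\<in>partitions n. int (largest_part P * size P))"
    \<comment> \<open>One copy of \<open>p2 n\<close> becomes the sum of squared largest parts, the
      other the sum of squared sizes.\<close>
    by (subst (1) p2_eq_sum_largest_part, subst p2_eq_sum)
       (simp only: sum_subtractf sum.distrib of_nat_sum sum_distrib_left)
  finally show ?thesis by simp
qed

text \<open>The Ferrers diagram fits into a rectangle with sides \<open>largest_part P\<close> and
  \<open>size P\<close>.\<close>

lemma partition_le_largest_part_mult_size:
  assumes "P \<in> partitions n"
  shows "n \<le> largest_part P * size P"
proof -
  have "sum_mset P \<le> N * size P" if "\<forall>x\<in>#P. x \<le> N" for N
    using that by (induction P) auto
  from this[of "largest_part P"] show ?thesis
    using assms largest_part_le_iff[of P "largest_part P"] by (simp add: partitions_def)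
qed

section \<open>The partition generating function\<close>

text \<open>For \<open>k > 0\<close> this is the geometric series 1/(1 - q^k).\<close>

definition geo :: "nat \<Rightarrow> rat fps" where
  "geo k = Abs_fps (\<lambda>n. if k dvd n then 1 else 0)"

lemma geo_mult:
  assumes "k > 0"
  shows "geo k * (1 - fps_X ^ k) = 1"
proof (rule fps_ext)
  fix n
  have "k dvd n - k \<longleftrightarrow> k dvd n" if "n \<ge> k" for n
    using that by (simp add: dvd_minus_self)
  moreover have "k dvd n \<Longrightarrow> n < k \<Longrightarrow> n = 0" by (auto dest: dvd_imp_le)
  ultimately show "fps_nth (geo k * (1 - fps_X ^ k)) n = fps_nth 1 n"
    using assms by (auto simp: right_diff_distrib fps_X_power_mult_right_nth geo_def)
qed

section \<open>The derivation q d/dq and the partition product\<close>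

definition theta :: "rat fps \<Rightarrow> rat fps" where
  "theta F = fps_X * fps_deriv F"

lemma theta_nth: "fps_nth (theta F) n = of_nat n * fps_nth F n"
  by (cases n) (simp_all add: theta_def)

lemma theta_mult: "theta (F * G) = theta F * G + F * theta G"
  by (simp add: theta_def algebra_simps)

lemma theta_X_power: "theta (fps_X ^ k) = of_nat k * fps_X ^ k"
  by (rule fps_ext) (simp add: theta_nth fps_X_power_nth fps_mult_of_nat_nth)

lemma theta_one_minus: "theta (1 - F) = - theta F"
  by (simp add: theta_def)

text \<open>Apply the product rule to \<open>geo k * (1 - fps_X ^ k) = 1\<close> and multiply by
  \<open>geo k\<close>.\<close>

lemma theta_geo:
  assumes "k > 0"
  shows "theta (geo k) = of_nat k * fps_X ^ k * (geo k)\<^sup>2"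
proof -
  have "theta (geo k * (1 - fps_X ^ k)) = 0"
    unfolding geo_mult[OF assms] by (simp add: theta_def)
  then have "theta (geo k) * (1 - fps_X ^ k) = of_nat k * fps_X ^ k * geo k"
    unfolding theta_mult theta_one_minus theta_X_power by (simp add: mult_ac)
  then have "theta (geo k) * (1 - fps_X ^ k) * geo k = of_nat k * fps_X ^ k * geo k * geo k"
    by (rule arg_cong)
  also have "theta (geo k) * (1 - fps_X ^ k) * geo k = theta (geo k) * (geo k * (1 - fps_X ^ k))"
    by (simp only: mult_ac)
  finally show ?thesis by (simp add: geo_mult[OF assms] power2_eq_square mult.assoc)
qed

definition partition_fps :: "nat \<Rightarrow> rat fps" where
  "partition_fps N = (\<Prod>i<N. geo (Suc i))"

text \<open>The recurrence \<open>card_partitions_max_Suc\<close> says that multiplication by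
  \<open>1 - fps_X ^ Suc N\<close> takes the generating function for \<open>Suc N\<close> to that
  for \<open>N\<close>; multiplying by \<open>geo (Suc N)\<close> inverts this.\<close>

lemma partition_fps_nth: "fps_nth (partition_fps N) n = of_nat (card (partitions_max N n))"
proof -
  have "partition_fps N = Abs_fps (\<lambda>n. of_nat (card (partitions_max N n)))"
  proof (induction N)
    case 0
    show ?case by (rule fps_ext) (simp add: partition_fps_def partitions_max_0)
  next
    case (Suc N)
    let ?A = "\<lambda>N. Abs_fps (\<lambda>n. of_nat (card (partitions_max N n))) :: rat fps"
    have "?A (Suc N) * (1 - fps_X ^ Suc N) = ?A N"
    proof (rule fps_ext)
      fix n
      show "fps_nth (?A (Suc N) * (1 - fps_X ^ Suc N)) n = fps_nth (?A N) n"
        using card_partitions_max_Suc[of N n]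
        by (simp add: right_diff_distrib fps_X_power_mult_right_nth del: power_Suc)
    qed
    then have "?A (Suc N) * (geo (Suc N) * (1 - fps_X ^ Suc N)) = ?A N * geo (Suc N)"
      by (metis mult.assoc mult.commute)
    then have "?A (Suc N) = ?A N * geo (Suc N)"
      by (simp only: geo_mult zero_less_Suc mult_1_right)
    then show ?case using Suc.IH by (simp add: partition_fps_def)
  qed
  then show ?thesis by simp
qed

text \<open>Logarithmic differentiation: by \<open>theta_geo\<close>, each factor
  \<open>geo k\<close> contributes \<open>of_nat k * fps_X ^ k * geo k\<close>.\<close>

lemma theta_partition_fps:
  "theta (partition_fps N)
    = partition_fps N * (\<Sum>i<N. of_nat (Suc i) * fps_X ^ Suc i * geo (Suc i))"
proof (induction N)
  case 0
  show ?case by (simp add: partition_fps_def theta_def)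
next
  case (Suc N)
  have "partition_fps (Suc N) = partition_fps N * geo (Suc N)"
    by (simp add: partition_fps_def)
  then show ?case
    by (simp only: theta_mult Suc.IH theta_geo zero_less_Suc sum.lessThan_Suc)
       (simp add: algebra_simps power2_eq_square)
qed

text \<open>Both coefficients are \<open>\<sigma>(i)\<close>, as the sum over the divisors of \<open>i\<close> and over their codivisors.\<close>

lemma lambert_series_nth_eq:
  assumes "i \<le> N"
  shows "fps_nth (\<Sum>j<N. of_nat (Suc j) * fps_X ^ Suc j * geo (Suc j)) i
       = fps_nth (\<Sum>j<N. fps_X ^ Suc j * (geo (Suc j))\<^sup>2) i"
proof (cases "i = 0")
  case True
  then show ?thesis by (simp add: fps_sum_nth fps_mult_nth_0)
next
  case False
  have l: "fps_nth (of_nat k * fps_X ^ k * geo k) i = (if k dvd i then of_nat k else 0)" if "k > 0" for k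
  proof -
    have "fps_X ^ k * geo k = geo k - 1"
      using geo_mult[OF that] by (simp add: algebra_simps)
    then have "of_nat k * fps_X ^ k * geo k = of_nat k * (geo k - 1)"
      by (simp only: mult.assoc)
    then have "fps_nth (of_nat k * fps_X ^ k * geo k) i = of_nat k * fps_nth (geo k - 1) i"
      by (simp only: fps_mult_of_nat_nth)
    then show ?thesis using False by (simp add: geo_def)
  qed
  have r: "fps_nth (fps_X ^ k * (geo k)\<^sup>2) i = (if k dvd i then of_nat (i div k) else 0)" if "k > 0" for k
  proof -
    \<comment> \<open>With the factor \<open>k\<close> the series is \<open>theta (geo k)\<close>,
      whose coefficient is \<open>i\<close> if \<open>k\<close> divides \<open>i\<close>; cancelling
      \<open>k\<close> leaves \<open>i div k\<close>.\<close>
    have "of_nat k * fps_nth (fps_X ^ k * (geo k)\<^sup>2) i = fps_nth (of_nat k * (fps_X ^ k * (geo k)\<^sup>2)) i"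
      by (simp add: fps_mult_of_nat_nth)
    also have "\<dots> = of_nat i * (if k dvd i then 1 else 0)"
      using theta_geo[OF that] theta_nth[of "geo k" i] by (simp add: geo_def mult.assoc)
    finally show ?thesis
      using that by (auto simp: of_nat_div field_simps elim!: dvdE)
  qed
  \<comment> \<open>Since 0 < i \<le> N, every divisor of \<open>i\<close> is \<open>Suc j\<close>
    for some \<open>j < N\<close>, so the truncation loses no divisor.\<close>
  have sum: "(\<Sum>j<N. if Suc j dvd i then h (Suc j) else 0) = (\<Sum>k | k dvd i. h k)"
    for h :: "nat \<Rightarrow> rat"
  proof -
    have "(\<Sum>j<N. if Suc j dvd i then h (Suc j) else 0) = (\<Sum>k\<in>{1..N}. if k dvd i then h k else 0)"
      by (rule sum.reindex_bij_witness[of _ "\<lambda>k. k - 1" Suc]) auto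
    also have "\<dots> = (\<Sum>k\<in>{k\<in>{1..N}. k dvd i}. h k)"
      by (rule sum.inter_filter[symmetric]) simp
    also have "{k\<in>{1..N}. k dvd i} = {k. k dvd i}"
      using assms False by (auto dest: dvd_imp_le intro!: Suc_leI intro: ccontr)
    finally show ?thesis .
  qed
  have "(\<Sum>k | k dvd i. of_nat k :: rat) = (\<Sum>k | k dvd i. of_nat (i div k))"
    using False by (intro sum.reindex_bij_witness[of _ "\<lambda>k. i div k" "\<lambda>k. i div k"]) auto
  then show ?thesis
    using sum[of "\<lambda>k. of_nat k"] sum[of "\<lambda>k. of_nat (i div k)"]
    by (simp only: fps_sum_nth l r zero_less_Suc)
qed

section \<open>Moments of the crank\<close>

text \<open>For finitely supported \<open>f\<close> this is (z d/dz)^j f evaluated at z = 1. As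
  \<open>Sum_any\<close> is 0 on infinite supports, the rules for products and sums below assume
  \<open>z_bounded\<close>.\<close>

definition zmoment :: "nat \<Rightarrow> rat fls \<Rightarrow> rat" where
  "zmoment j f = Sum_any (\<lambda>m. of_int m ^ j * fls_nth f m)"

definition moment_fps :: "nat \<Rightarrow> rat fls fps \<Rightarrow> rat fps" where
  "moment_fps j F = Abs_fps (\<lambda>n. zmoment j (fps_nth F n))"

lemma zmoment_bounded:
  assumes "z_bounded a f"
  shows "zmoment j f = (\<Sum>m\<in>{-int a..int a}. of_int m ^ j * fls_nth f m)"
  unfolding zmoment_def
proof (rule Sum_any.expand_superset)
  show "{m. of_int m ^ j * fls_nth f m \<noteq> 0} \<subseteq> {-int a..int a}"
    using assms by (force simp: z_bounded_def abs_le_iff not_less)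
qed simp

lemma zmoment_0 [simp]: "zmoment j 0 = 0"
  by (simp add: zmoment_def)

lemma zmoment_uminus: "zmoment j (- f) = - zmoment j f"
  by (simp add: zmoment_def Sum_any.expand_set sum_negf)

lemma zmoment_X_intpow: "zmoment j (fls_X_intpow s) = of_int s ^ j"
proof -
  have "zmoment j (fls_X_intpow s) = (\<Sum>m\<in>{s}. of_int m ^ j * fls_nth (fls_X_intpow s) m)"
    unfolding zmoment_def by (rule Sum_any.expand_superset) auto
  then show ?thesis by simp
qed

section \<open>Leibniz rules for moments\<close>

lemma z_bounded_mult_nth:
  assumes "z_bounded a f"
  shows "fls_nth (f * g) m = (\<Sum>i\<in>{-int a..int a}. fls_nth f i * fls_nth g (m - i))"
proof -
  have "fls_nth (f * g) m
      = (\<Sum>i\<in>{fls_subdegree f..m - fls_subdegree g}. fls_nth f i * fls_nth g (m - i))"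
    by (rule fls_times_nth(2))
  \<comment> \<open>The union serves as a common superset: outside the first range a factor lies
    below its subdegree, outside the second \<open>f\<close> vanishes.\<close>
  also have "\<dots> = (\<Sum>i\<in>{fls_subdegree f..m - fls_subdegree g} \<union> {-int a..int a}.
      fls_nth f i * fls_nth g (m - i))"
    by (rule sum.mono_neutral_left) (auto simp: not_le)
  also have "\<dots> = (\<Sum>i\<in>{-int a..int a}. fls_nth f i * fls_nth g (m - i))"
    using assms by (intro sum.mono_neutral_right) (auto simp: z_bounded_def)
  finally show ?thesis .
qed

text \<open>Substitute \<open>m = i + l\<close> in the Cauchy product. For each \<open>i\<close> the
  shifted range of \<open>l\<close> lies inside the range of \<open>m\<close>, and the bound on
  \<open>g\<close> kills the remaining terms.\<close>

lemma zmoment_mult_double: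
  assumes f: "z_bounded a f" and g: "z_bounded b g"
  shows "zmoment j (f * g) = (\<Sum>i\<in>{-int a..int a}. \<Sum>l\<in>{-int b..int b}.
    of_int (i + l) ^ j * (fls_nth f i * fls_nth g l))"
proof -
  have "zmoment j (f * g) = (\<Sum>m\<in>{-int (a + b)..int (a + b)}. \<Sum>i\<in>{-int a..int a}.
      of_int m ^ j * (fls_nth f i * fls_nth g (m - i)))"
    by (simp only: zmoment_bounded[OF z_bounded_mult[OF f g]] z_bounded_mult_nth[OF f] sum_distrib_left)
  also have "\<dots> = (\<Sum>i\<in>{-int a..int a}. \<Sum>m\<in>{-int (a + b)..int (a + b)}.
      of_int m ^ j * (fls_nth f i * fls_nth g (m - i)))"
    by (rule sum.swap)
  also have "\<dots> = (\<Sum>i\<in>{-int a..int a}. \<Sum>l\<in>{-int b..int b}.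
    of_int (i + l) ^ j * (fls_nth f i * fls_nth g l))"
  proof (rule sum.cong)
    fix i assume i: "i \<in> {-int a..int a}"
    have "(\<Sum>l\<in>{-int b..int b}. of_int (i + l) ^ j * (fls_nth f i * fls_nth g l))
        = (\<Sum>m\<in>{i - int b..i + int b}. of_int m ^ j * (fls_nth f i * fls_nth g (m - i)))"
      by (rule sum.reindex_bij_witness[of _ "\<lambda>m. m - i" "\<lambda>l. i + l"]) auto
    also have "\<dots> = (\<Sum>m\<in>{-int (a + b)..int (a + b)}.
        of_int m ^ j * (fls_nth f i * fls_nth g (m - i)))"
      using i g by (intro sum.mono_neutral_left) (auto simp: z_bounded_def)
    finally show "(\<Sum>m\<in>{-int (a + b)..int (a + b)}. of_int m ^ j * (fls_nth f i * fls_nth g (m - i)))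
        = (\<Sum>l\<in>{-int b..int b}. of_int (i + l) ^ j * (fls_nth f i * fls_nth g l))" ..
  qed simp
  finally show ?thesis .
qed

text \<open>The Leibniz rule for (z d/dz)^j at z = 1, obtained from the binomial expansion of
  \<open>(i + l) ^ j\<close>.\<close>

lemma zmoment_mult:
  assumes f: "z_bounded a f" and g: "z_bounded b g"
  shows "zmoment j (f * g) = (\<Sum>r\<le>j. of_nat (j choose r) * (zmoment r f * zmoment (j - r) g))"
proof -
  have "zmoment j (f * g) = (\<Sum>i\<in>{-int a..int a}. \<Sum>l\<in>{-int b..int b}. \<Sum>r\<le>j.
      of_nat (j choose r) * ((of_int i ^ r * fls_nth f i) * (of_int l ^ (j - r) * fls_nth g l)))"
    unfolding zmoment_mult_double[OF f g] of_int_add binomial_ring sum_distrib_right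
    by (intro sum.cong refl) (simp only: mult_ac)
  also have "\<dots> = (\<Sum>i\<in>{-int a..int a}. \<Sum>r\<le>j. \<Sum>l\<in>{-int b..int b}.
      of_nat (j choose r) * ((of_int i ^ r * fls_nth f i) * (of_int l ^ (j - r) * fls_nth g l)))"
    by (intro sum.cong refl sum.swap)
  also have "\<dots> = (\<Sum>r\<le>j. \<Sum>i\<in>{-int a..int a}. \<Sum>l\<in>{-int b..int b}.
      of_nat (j choose r) * ((of_int i ^ r * fls_nth f i) * (of_int l ^ (j - r) * fls_nth g l)))"
    by (rule sum.swap)
  also have "\<dots> = (\<Sum>r\<le>j. of_nat (j choose r) * (zmoment r f * zmoment (j - r) g))"
    by (simp only: zmoment_bounded[OF f] zmoment_bounded[OF g] sum_product)
       (simp only: sum_distrib_left)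
  finally show ?thesis .
qed

lemma zmoment_sum:
  assumes "finite A" "\<And>i. i \<in> A \<Longrightarrow> z_bounded a (f i)"
  shows "zmoment j (sum f A) = (\<Sum>i\<in>A. zmoment j (f i))"
proof -
  have "zmoment j (sum f A) = (\<Sum>m\<in>{-int a..int a}. \<Sum>i\<in>A. of_int m ^ j * fls_nth (f i) m)"
    using zmoment_bounded[OF z_bounded_sum[OF assms(2)]] by (simp add: fls_nth_sum sum_distrib_left)
  also have "\<dots> = (\<Sum>i\<in>A. \<Sum>m\<in>{-int a..int a}. of_int m ^ j * fls_nth (f i) m)"
    by (rule sum.swap)
  also have "\<dots> = (\<Sum>i\<in>A. zmoment j (f i))"
    using zmoment_bounded[OF assms(2)] by (intro sum.cong refl) simp
  finally show ?thesis .
qed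

text \<open>The Leibniz rule lifts through the Cauchy product in q: the terms of the
  \<open>n\<close>-th coefficient have z-bounds \<open>i + (n - i) = n\<close>, a common bound that
  lets \<open>zmoment\<close> pass through the sum.\<close>

lemma moment_fps_mult:
  assumes F: "qz_bounded F" and G: "qz_bounded G"
  shows "moment_fps j (F * G)
    = (\<Sum>r\<le>j. of_nat (j choose r) * (moment_fps r F * moment_fps (j - r) G))"
proof (rule fps_ext)
  fix n
  have b: "z_bounded i (fps_nth F i)" "z_bounded i (fps_nth G i)" for i
    using F G by (auto simp: qz_bounded_def)
  have "zmoment j (\<Sum>i=0..n. fps_nth F i * fps_nth G (n - i))
      = (\<Sum>i=0..n. zmoment j (fps_nth F i * fps_nth G (n - i)))"
  proof (rule zmoment_sum[where a = n])
    show "z_bounded n (fps_nth F i * fps_nth G (n - i))" if "i \<in> {0..n}" for i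
      using z_bounded_mult[OF b, of i "n - i"] that by simp
  qed simp
  also have "\<dots> = (\<Sum>i=0..n. \<Sum>r\<le>j.
      of_nat (j choose r) * (zmoment r (fps_nth F i) * zmoment (j - r) (fps_nth G (n - i))))"
    by (simp only: zmoment_mult[OF b])
  also have "\<dots> = (\<Sum>r\<le>j. \<Sum>i=0..n.
      of_nat (j choose r) * (zmoment r (fps_nth F i) * zmoment (j - r) (fps_nth G (n - i))))"
    by (rule sum.swap)
  finally show "fps_nth (moment_fps j (F * G)) n
      = fps_nth (\<Sum>r\<le>j. of_nat (j choose r) * (moment_fps r F * moment_fps (j - r) G)) n"
    by (simp only: fps_sum_nth fps_mult_of_nat_nth)
       (simp add: moment_fps_def fps_mult_nth sum_distrib_left)
qed

lemma moment_fps_012_mult: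
  assumes "qz_bounded F" "qz_bounded G"
  shows "moment_fps 0 (F * G) = moment_fps 0 F * moment_fps 0 G"
    and "moment_fps 1 (F * G) = moment_fps 0 F * moment_fps 1 G + moment_fps 1 F * moment_fps 0 G"
    and "moment_fps 2 (F * G) = moment_fps 0 F * moment_fps 2 G
      + 2 * (moment_fps 1 F * moment_fps 1 G) + moment_fps 2 F * moment_fps 0 G"
  unfolding moment_fps_mult[OF assms] by (simp_all add: numeral_2_eq_2)

section \<open>Moments of the crank factors and of their product\<close>

lemma moment_fps_linear:
  assumes "k > 0"
  shows "moment_fps j (1 - fps_const (fls_X_intpow s) * fps_X ^ k)
    = fps_const (0 ^ j) - fps_const (of_int s ^ j) * fps_X ^ k"
proof -
  \<comment> \<open>Here \<open>0 ^ 0 = 1\<close>: the constant 1 contributes to the zeroth moment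
    only.\<close>
  have "zmoment j 1 = 0 ^ j" using zmoment_X_intpow[of j 0] by simp
  then show ?thesis
    using assms by (intro fps_ext)
      (auto simp: moment_fps_def fps_X_power_nth zmoment_X_intpow zmoment_uminus)
qed

lemma qz_bounded_linear:
  assumes "k > 0" "\<bar>s\<bar> \<le> 1"
  shows "qz_bounded (1 - fps_const (fls_X_intpow s) * fps_X ^ k)"
  using assms by (auto simp: qz_bounded_def z_bounded_def fps_X_power_nth)

text \<open>The Leibniz rules for factor times denominator = numerator form a triangular system,
  solved for the moments 0, 1, 2 in turn.\<close>

lemma moment_fps_crank_factor:
  assumes k: "k > 0"
  shows "moment_fps 0 (crank_factor k) = geo k"
    and "moment_fps 1 (crank_factor k) = 0"
    and "moment_fps 2 (crank_factor k) = geo k * (2 * (fps_X ^ k * (geo k)\<^sup>2))"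
proof -
  define x :: "rat fps" where "x = fps_X ^ k"
  \<comment> \<open>\<open>L 0\<close> is the numerator; \<open>L 1\<close> and
    \<open>L (-1)\<close> are the denominator factors, whose opposite first moments cancel in the
    product.\<close>
  define L :: "int \<Rightarrow> rat fls fps" where "L s = 1 - fps_const (fls_X_intpow s) * fps_X ^ k" for s
  have L0: "moment_fps 0 (L s) = 1 - x" for s
    by (simp add: L_def x_def moment_fps_linear[OF k])
  have L1: "moment_fps 1 (L 1) = - x" "moment_fps 1 (L (-1)) = x" "moment_fps 1 (L 0) = 0"
    unfolding L_def x_def moment_fps_linear[OF k] by (simp_all flip: fps_const_neg)
  have L2: "moment_fps 2 (L 1) = - x" "moment_fps 2 (L (-1)) = - x" "moment_fps 2 (L 0) = 0"
    unfolding L_def x_def moment_fps_linear[OF k] by simp_all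
  note L = L0 L1 L2
  have bL: "qz_bounded (L s)" if "\<bar>s\<bar> \<le> 1" for s
    unfolding L_def by (rule qz_bounded_linear[OF k that])
  have "L 1 = 1 - fps_const fls_X * fps_X ^ k" "L (-1) = 1 - fps_const fls_X_inv * fps_X ^ k"
    by (simp_all add: L_def fls_X_conv_shift_1 fls_X_inv_conv_shift_1)
  then have denom: "crank_denom k = L 1 * L (-1)"
    by (simp add: crank_denom_def)
  have bD: "qz_bounded (crank_denom k)"
    unfolding denom by (intro qz_bounded_mult bL) auto
  have D: "moment_fps 0 (crank_denom k) = (1 - x)\<^sup>2" "moment_fps 1 (crank_denom k) = 0"
    "moment_fps 2 (crank_denom k) = - 2 * x"
    unfolding denom
    by (simp_all only: moment_fps_012_mult bL L abs_one abs_minus order_refl)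
       (simp_all add: power2_eq_square algebra_simps)
  let ?C = "crank_factor k"
  note bC = qz_bounded_crank_factor[OF k]
  have "crank_denom k * inverse (crank_denom k) = 1"
    by (intro inverse_mult_eq_1') (simp add: crank_denom_nth_0[OF k])
  then have eq: "?C * crank_denom k = L 0"
    unfolding crank_factor_eq[OF k] L_def by (simp add: mult_ac)
  have g: "(1 - x) * geo k = 1"
    using geo_mult[OF k] by (simp add: x_def mult.commute)
  \<comment> \<open>Multiplication by \<open>(geo k)\<^sup>2\<close> undoes the zeroth moment
    \<open>(1 - x)\<^sup>2\<close> of the denominator.\<close>
  have g': "y * (1 - x)\<^sup>2 * (geo k)\<^sup>2 = y" for y
    using g by (metis mult.assoc mult_1_right power_mult_distrib power_one)
  have "moment_fps 0 ?C * (1 - x)\<^sup>2 = 1 - x"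
    using moment_fps_012_mult(1)[OF bC bD] unfolding eq L D by simp
  then have "moment_fps 0 ?C = (1 - x) * (geo k)\<^sup>2"
    using g' by metis
  also have "\<dots> = geo k" using g by (metis mult.assoc mult_1 power2_eq_square)
  finally show m0: "moment_fps 0 ?C = geo k" .
  have "moment_fps 1 ?C * (1 - x)\<^sup>2 = 0"
    using moment_fps_012_mult(2)[OF bC bD] unfolding eq L D by simp
  then show "moment_fps 1 ?C = 0"
    using g' by (metis mult_zero_left)
  have "moment_fps 2 ?C * (1 - x)\<^sup>2 = geo k * (2 * x)"
    using moment_fps_012_mult(3)[OF bC bD] unfolding eq L D m0 by (simp add: algebra_simps)
  then have "moment_fps 2 ?C = geo k * (2 * x) * (geo k)\<^sup>2"
    using g' by metis
  then show "moment_fps 2 ?C = geo k * (2 * (fps_X ^ k * (geo k)\<^sup>2))"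
    by (simp add: x_def mult_ac)
qed

text \<open>Vanishing first moments remove the cross term of the Leibniz rule, so second moment over
  zeroth moment is additive over the factors. Boundedness and the first moment are carried along to
  apply that rule in the induction.\<close>

lemma crank_product_moments:
  defines "C \<equiv> \<lambda>N. \<Prod>i<N. crank_factor (Suc i)"
  shows "qz_bounded (C N) \<and> moment_fps 0 (C N) = partition_fps N \<and> moment_fps 1 (C N) = 0 \<and>
    moment_fps 2 (C N) = partition_fps N * (2 * (\<Sum>i<N. fps_X ^ Suc i * (geo (Suc i))\<^sup>2))"
proof (induction N)
  case 0
  have "moment_fps j 1 = fps_const (0 ^ j)" for j
    using zmoment_X_intpow[of j 0] by (intro fps_ext) (simp add: moment_fps_def)
  moreover have "qz_bounded 1" by (auto simp: qz_bounded_def z_bounded_def)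
  ultimately show ?case by (simp add: C_def partition_fps_def)
next
  case (Suc N)
  let ?F = "crank_factor (Suc N)"
  have C: "C (Suc N) = C N * ?F" by (simp add: C_def)
  have P: "partition_fps (Suc N) = partition_fps N * geo (Suc N)" by (simp add: partition_fps_def)
  have b: "qz_bounded (C N)" "qz_bounded ?F"
    using Suc.IH qz_bounded_crank_factor by auto
  note m = moment_fps_012_mult[OF b] moment_fps_crank_factor[OF zero_less_Suc]
  have "qz_bounded (C (Suc N))" unfolding C using b by (rule qz_bounded_mult)
  moreover have "moment_fps 0 (C (Suc N)) = partition_fps (Suc N)"
    unfolding C P m using Suc.IH by simp
  moreover have "moment_fps 1 (C (Suc N)) = 0"
    unfolding C m using Suc.IH by simp
  moreover have "moment_fps 2 (C (Suc N)) = partition_fps (Suc N) *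
      (2 * (\<Sum>i<Suc N. fps_X ^ Suc i * (geo (Suc i))\<^sup>2))"
    unfolding C P m using Suc.IH by (simp add: algebra_simps)
  ultimately show ?case by blast
qed

text \<open>The second moment is twice \<open>partition_fps ?N * ?S\<close>. Up to degree
  \<open>n\<close>, \<open>?S\<close> agrees with \<open>?T\<close>, the logarithmic derivative of
  \<open>partition_fps ?N\<close>, so the product becomes \<open>theta (partition_fps ?N)\<close>
  and yields the factor \<open>n\<close>.\<close>

lemma M2_eq: "M2 n = of_nat (2 * n * card (partitions n))"
proof -
  \<comment> \<open>\<open>crank_gf_nth\<close> uses the factors with index
    \<open>i \<le> n\<close>, which are \<open>n + 1\<close> in number.\<close>
  let ?N = "Suc n"
  let ?S = "\<Sum>i<?N. fps_X ^ Suc i * (geo (Suc i))\<^sup>2"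
  let ?T = "\<Sum>i<?N. of_nat (Suc i) * fps_X ^ Suc i * geo (Suc i)"
  have "M2 n = fps_nth (moment_fps 2 (\<Prod>i<?N. crank_factor (Suc i))) n"
    by (simp add: M2_def M_crank_def crank_gf_nth moment_fps_def zmoment_def lessThan_Suc_atMost)
  also have "moment_fps 2 (\<Prod>i<?N. crank_factor (Suc i)) = partition_fps ?N * (2 * ?S)"
    using crank_product_moments[of ?N] by blast
  also have "partition_fps ?N * (2 * ?S) = 2 * (partition_fps ?N * ?S)"
    by (simp only: mult_ac)
  also have "fps_nth \<dots> n = 2 * fps_nth (partition_fps ?N * ?S) n"
    using fps_mult_of_nat_nth(1)[of 2 "partition_fps ?N * ?S" n] by simp
  also have "fps_nth (partition_fps ?N * ?S) n = fps_nth (partition_fps ?N * ?T) n"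
    unfolding fps_mult_nth
    by (intro sum.cong refl arg_cong2[where f = times] lambert_series_nth_eq[symmetric]) auto
  also have "\<dots> = of_nat n * fps_nth (partition_fps ?N) n"
    by (simp only: theta_partition_fps[symmetric] theta_nth)
  also have "partitions_max ?N n = partitions n"
    using part_le_of_partition by (force simp: partitions_max_def)
  then have "fps_nth (partition_fps ?N) n = of_nat (card (partitions n))"
    by (simp add: partition_fps_nth)
  finally show ?thesis by simp
qed

theorem theorem1p2:
  fixes n :: nat
  shows "M2 n + of_int (N2 n) \<le> 2 * of_nat (p2 n)"
proof -
  have "n * card (partitions n) \<le> (\<Sum>P\<in>partitions n. largest_part P * size P)"
    using sum_mono[of "partitions n" "\<lambda>_. n" "\<lambda>P. largest_part P * size P"]
      partition_le_largest_part_mult_size by (simp add: mult.commute)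
  then have "int (2 * n * card (partitions n)) + N2 n \<le> 2 * int (p2 n)"
    unfolding N2_eq of_nat_sum[symmetric] by linarith
  \<comment> \<open>\<open>M2\<close> is rational-valued, so the integer inequality is transferred
    along the order embedding \<open>of_int\<close>.\<close>
  then have "(of_int (int (2 * n * card (partitions n)) + N2 n) :: rat) \<le> of_int (2 * int (p2 n))"
    by (simp only: of_int_le_iff)
  then show ?thesis by (simp add: M2_eq)
qed

end
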